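(* Let $X\sim P\in\mathcal{E}(O,\Lambda)$ and assume that $\phi_1(S_P)>1/2$. Let $X_1,X_2,\ldots$ be i.i.d. from $P$, and for each $n$ let $v_n$ be any minimizer of $f_{P_n}$ over $\mathcal{B}(H_n+1/2)$. Let $\psi>0$ be such that $\pm\psi o_1$ are the minimizers of $f_P$ over $\mathbb{R}^p$. Then there exists a sequence of (sample-dependent) signs $s_n\in\{-1,1\}$ such that $s_nv_n\to\psi o_1$ in probability as $n\to\infty$.
   Context: Let $p\ge 2$ be an integer. $\|\cdot\|$ is the Euclidean norm and $'$ denotes transpose. $\mathcal{O}^p$ is the set of $p\times p$ orthogonal matrices; $o_1,\ldots,o_p$ denote the columns of $O$. $\mathcal{D}_1^p=\{\sigma\,\mathrm{diag}(\lambda,1,\ldots,1)\mid \sigma>0,\ \lambda>1\}$ (diagonal $p\times p$ matrices). For fixed $O\in\mathcal{O}^p$ and $\Lambda\in\mathcal{D}_1^p$, a probability distribution $P$ on $\mathbb{R}^p$ belongs to $\mathcal{E}(O,\Lambda)$ if $X\sim P$ admits the representation $X=O\Lambda Z$ for some random $p$-vector $Z$ such that: (1) $Z$ is spherical, i.e. $VZ$ has the same distribution as $Z$ for every $V\in\mathcal{O}^p$; (2) $R:=\|Z\|$ admits a density $f_R:(0,\infty)\to(0,\infty)$ with respect to Lebesgue measure; (3) $r\mapsto f_R(r)/r^{p-1}$ is strictly decreasing on $(0,\infty)$; (4) $\mathrm{E}(R)<\infty$. $S_P=\mathrm{E}(XX'/\|X\|^2)$ and $\phi_1(S_P)$ is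 its largest eigenvalue. $f_P(v)=\mathrm{E}(\|X-v\|\,\|X+v\|-\|X\|^2)$; when $\phi_1(S_P)>1/2$ there is a unique $\psi>0$ such that the minimizers of $f_P$ over $\mathbb{R}^p$ are precisely $\pm\psi o_1$. The sample objective is $f_{P_n}(v)=\frac1n\sum_{i=1}^n(\|X_i-v\|\,\|X_i+v\|-\|X_i\|^2)$, where $P_n$ is the empirical distribution of $X_1,\ldots,X_n$. $\mathcal{B}(\rho)=\{x\in\mathbb{R}^p\mid\|x\|\le \rho\}$. The data-dependent radius $H_n$ is defined as follows. Let $G_n$ be the empirical distribution of $\|X_1\|,\ldots,\|X_n\|$ and $R_{n0}:=Q_{0.75}(G_n)$ its $0.75$-quantile ($Q_q(G)=\inf\{t: G((-\infty,t])\ge q\}$). Let $y_n(h):=[2P_n\{X\in\mathcal{B}(R_{n0})\}-1]h^2-2hR_{n0}-R_{n0}^2-f_{P_n}(0)$, where $P_n\{X\in\mathcal B(R_{n0})\}$ is the proportion of sample points in $\mathcal B(R_{n0})$, let $H_{n0}$ be the largest root of the polynomial $y_n$, and put $H_n:=H_{n0}+1$. *)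

theory Defs
  imports "HOL-Probability.Probability" "HOL-Computational_Algebra.Polynomial"
begin

text \<open>
  Vectors of \<open>\<real>\<^sup>p\<close> have type \<open>real ^ 'p\<close>. As the index type \<open>'p\<close> carries no order, the
  coordinate that plays the role of the first one is an explicit parameter \<open>k\<close>.
\<close>

definition spiked_scales :: "'p \<Rightarrow> (real ^ 'p ^ 'p) set" where
  "spiked_scales k =
     {\<sigma> *\<^sub>R (\<chi> i j. if i = j then (if i = k then l else 1) else 0) | \<sigma> l. 0 < \<sigma> \<and> 1 < l}"

definition spherical :: "(real ^ 'p) measure \<Rightarrow> bool" where
  "spherical Q \<longleftrightarrow> (\<forall>V. orthogonal_matrix V \<longrightarrow> distr Q borel (\<lambda>z. V *v z) = Q)"

text \<open>
  All conditions on the random vector \<open>Z\<close> concern its law only, which is \<open>Q\<close> below. The density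
  of the radius lives on \<open>(0,\<infinity>)\<close>; it is extended by \<open>0\<close>, so in particular the law of the
  radius does not charge \<open>0\<close>.
\<close>

definition elliptical_class :: "real ^ 'p ^ 'p \<Rightarrow> real ^ 'p ^ 'p \<Rightarrow> (real ^ 'p) measure set" where
  "elliptical_class O\<^sub>P \<Lambda> =
     {P. \<exists>Q. prob_space Q \<and> sets Q = sets borel \<and>
             P = distr Q borel (\<lambda>z. (O\<^sub>P ** \<Lambda>) *v z) \<and>
             spherical Q \<and>
             (\<exists>f :: real \<Rightarrow> real.
                (\<forall>r>0. 0 < f r) \<and>
                distributed Q lborel norm (\<lambda>r. ennreal (if 0 < r then f r else 0)) \<and>
                strict_antimono_on {0<..} (\<lambda>r. f r / r ^ (CARD('p) - 1))) \<and>
             integrable Q norm}"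

definition sign_covariance :: "(real ^ 'p) measure \<Rightarrow> real ^ 'p ^ 'p" where
  "sign_covariance P = (\<chi> i j. \<integral>x. x $ i * x $ j / (norm x)\<^sup>2 \<partial>P)"

definition largest_eigenvalue :: "real ^ 'p ^ 'p \<Rightarrow> real" where
  "largest_eigenvalue A = Max {c. \<exists>v. v \<noteq> 0 \<and> A *v v = c *\<^sub>R v}"

definition objective :: "(real ^ 'p) measure \<Rightarrow> real ^ 'p \<Rightarrow> real" where
  "objective P v = (\<integral>x. norm (x - v) * norm (x + v) - (norm x)\<^sup>2 \<partial>P)"

text \<open>A sample of size \<open>n\<close> consists of the values \<open>x 0, \<dots>, x (n - 1)\<close>.\<close>

definition empirical :: "nat \<Rightarrow> (nat \<Rightarrow> 'b :: topological_space) \<Rightarrow> 'b measure" where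
  "empirical n x = distr (uniform_count_measure {..<n}) borel x"

definition sample_objective :: "nat \<Rightarrow> (nat \<Rightarrow> real ^ 'p) \<Rightarrow> real ^ 'p \<Rightarrow> real" where
  "sample_objective n x v =
     (1 / real n) * (\<Sum>i<n. norm (x i - v) * norm (x i + v) - (norm (x i))\<^sup>2)"

lemma objective_empirical: "objective (empirical n x) v = sample_objective n x v"
proof -
  have "x \<in> uniform_count_measure {..<n} \<rightarrow>\<^sub>M borel"
    by (simp add: measurable_def space_uniform_count_measure sets_uniform_count_measure)
  then have "objective (empirical n x) v =
      (\<integral>i. norm (x i - v) * norm (x i + v) - (norm (x i))\<^sup>2 \<partial>uniform_count_measure {..<n})"
    unfolding objective_def empirical_def by (intro integral_distr) measurable
  then show ?thesis
    by (simp add: integral_uniform_count_measure sample_objective_def)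
qed

lemma measure_empirical:
  assumes "A \<in> sets borel"
  shows "measure (empirical n x) A = real (card {i \<in> {..<n}. x i \<in> A}) / real n"
proof -
  have "x \<in> uniform_count_measure {..<n} \<rightarrow>\<^sub>M borel"
    by (simp add: measurable_def space_uniform_count_measure sets_uniform_count_measure)
  moreover have "x -` A \<inter> {..<n} = {i \<in> {..<n}. x i \<in> A}"
    by auto
  ultimately show ?thesis
    using assms
    by (simp add: empirical_def measure_distr space_uniform_count_measure
        measure_uniform_count_measure subset_eq)
qed

definition quantile :: "real \<Rightarrow> real measure \<Rightarrow> real" where
  "quantile q G = Inf {t. q \<le> measure G {..t}}"

definition radius_quantile :: "nat \<Rightarrow> (nat \<Rightarrow> real ^ 'p) \<Rightarrow> real" where
  "radius_quantile n x = quantile (3 / 4) (empirical n (\<lambda>i. norm (x i)))"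

definition radius_poly :: "nat \<Rightarrow> (nat \<Rightarrow> real ^ 'p) \<Rightarrow> real poly" where
  "radius_poly n x =
     (let r = radius_quantile n x
      in [: - r\<^sup>2 - sample_objective n x 0, - 2 * r,
            2 * measure (empirical n x) (cball 0 r) - 1 :])"

definition search_radius :: "nat \<Rightarrow> (nat \<Rightarrow> real ^ 'p) \<Rightarrow> real" where
  "search_radius n x = Max {h. poly (radius_poly n x) h = 0} + 1"

text \<open>
  Stated with outer probability, so that it makes sense for maps that are not assumed to be
  measurable, such as arbitrary selections of minimizers. On measurable events
  \<^const>\<open>outer_measure_of\<close> agrees with \<^const>\<open>emeasure\<close>, so for random vectors this is the
  usual notion.
\<close>

definition tendsto_in_prob ::
    "'a measure \<Rightarrow> (nat \<Rightarrow> 'a \<Rightarrow> 'b :: metric_space) \<Rightarrow> 'b \<Rightarrow> bool" where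
  "tendsto_in_prob M Y c \<longleftrightarrow>
     (\<forall>\<epsilon>>0. (\<lambda>n. outer_measure_of M {\<omega> \<in> space M. \<epsilon> < dist (Y n \<omega>) c}) \<longlonglongrightarrow> 0)"

lemma (in prob_space) tendsto_in_prob_measurable_iff:
  fixes Y :: "nat \<Rightarrow> 'a \<Rightarrow> 'b :: {metric_space, second_countable_topology}"
  assumes [measurable]: "\<And>n. random_variable borel (Y n)"
  shows "tendsto_in_prob M Y c \<longleftrightarrow>
    (\<forall>\<epsilon>>0. (\<lambda>n. prob {\<omega> \<in> space M. \<epsilon> < dist (Y n \<omega>) c}) \<longlonglongrightarrow> 0)"
proof -
  have "outer_measure_of M {\<omega> \<in> space M. \<epsilon> < dist (Y n \<omega>) c} =
      ennreal (prob {\<omega> \<in> space M. \<epsilon> < dist (Y n \<omega>) c})" for \<epsilon> n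
    by (simp add: emeasure_eq_measure)
  then show ?thesis
    by (simp add: tendsto_in_prob_def ennreal_tendsto_0_iff)
qed

end

theory Submission
  imports Defs
begin

text \<open>
  The integrand of the objective is bounded by \<open>\<parallel>v\<parallel>\<^sup>2\<close> and, for \<open>v\<close> in a fixed ball, Lipschitz
  in \<open>v\<close> uniformly in \<open>x\<close>. Hence Hoeffding's inequality on a finite net gives uniform
  convergence on compact sets. If a ball centred at \<open>0\<close> contains well over half of the mass,
  the objective is positive (larger than at \<open>0\<close>) at all points far outside that ball. Applied
  to the quantile ball, this makes \<open>v\<^sub>n\<close> no worse than any point of the whole space; applied to
  a fixed large ball, it confines \<open>v\<^sub>n\<close> to a compact set with probability tending to one. On
  this compact set minus neighbourhoods of \<open>\<plusminus>\<psi> o\<^sub>1\<close>, the population objective exceeds its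
  minimum by a positive amount.
\<close>

section \<open>The integrand\<close>

definition loss :: "'b :: real_inner \<Rightarrow> 'b \<Rightarrow> real" where
  "loss v x = norm (x - v) * norm (x + v) - (norm x)\<^sup>2"

lemma continuous_on_loss: "continuous_on A (loss v)"
  unfolding loss_def by (intro continuous_intros)

lemma borel_measurable_loss [measurable]:
  "loss v \<in> borel_measurable (borel :: 'b :: {real_inner, second_countable_topology} measure)"
  by (intro borel_measurable_continuous_onI continuous_on_loss)

text \<open>With q = ||x||^2 + ||v||^2 the squared factors are q - 2 x.v and q + 2 x.v. Squaring
  removes the roots, so bounds on the product come from this identity and Cauchy-Schwarz.\<close>

lemma power2_norm_diff_mult_norm_add:
  fixes x v :: "'b :: real_inner"
  shows "(norm (x - v) * norm (x + v))\<^sup>2 = ((norm x)\<^sup>2 + (norm v)\<^sup>2)\<^sup>2 - 4 * (x \<bullet> v)\<^sup>2"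
  unfolding power_mult_distrib power2_norm_eq_inner
  by (simp add: inner_diff_left inner_diff_right inner_add_left inner_add_right
      inner_commute[of v x] power2_eq_square algebra_simps)

lemma abs_diff_le_norm_diff_mult_norm_add:
  fixes x v :: "'b :: real_inner"
  shows "\<bar>(norm x)\<^sup>2 - (norm v)\<^sup>2\<bar> \<le> norm (x - v) * norm (x + v)"
proof -
  have "(x \<bullet> v)\<^sup>2 \<le> (norm x)\<^sup>2 * (norm v)\<^sup>2"
    using power_mono[OF Cauchy_Schwarz_ineq2[of x v], of 2] by (simp add: power_mult_distrib)
  then have "((norm x)\<^sup>2 - (norm v)\<^sup>2)\<^sup>2 \<le> (norm (x - v) * norm (x + v))\<^sup>2"
    unfolding power2_norm_diff_mult_norm_add by (simp add: power2_eq_square algebra_simps)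
  then show ?thesis
    unfolding abs_le_square_iff[symmetric] by simp
qed

lemma norm_diff_mult_norm_add_le:
  fixes x v :: "'b :: real_inner"
  shows "norm (x - v) * norm (x + v) \<le> (norm x)\<^sup>2 + (norm v)\<^sup>2"
proof (rule power2_le_imp_le)
  show "(norm (x - v) * norm (x + v))\<^sup>2 \<le> ((norm x)\<^sup>2 + (norm v)\<^sup>2)\<^sup>2"
    unfolding power2_norm_diff_mult_norm_add by simp
qed simp

text \<open>The product of norms lies between | ||x||^2 - ||v||^2 | and ||x||^2 + ||v||^2. The bound
  is uniform in x, which gives integrability and makes Hoeffding's inequality applicable.\<close>

lemma abs_loss_le: "\<bar>loss v x\<bar> \<le> (norm v)\<^sup>2"
  using norm_diff_mult_norm_add_le[of x v] abs_diff_le_norm_diff_mult_norm_add[of x v]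
  unfolding loss_def by linarith

lemma loss_ge: "(norm v)\<^sup>2 - 2 * (norm x)\<^sup>2 \<le> loss v x"
  using abs_diff_le_norm_diff_mult_norm_add[of x v] unfolding loss_def by linarith

text \<open>
  The naive Lipschitz constant grows with \<open>\<parallel>x\<parallel>\<close>. For large \<open>x\<close> it is the difference of the
  squares of the products that is estimated, and divided by the sum of the products, which is
  of order \<open>\<parallel>x\<parallel>\<^sup>2\<close>.
\<close>

lemma loss_lipschitz:
  fixes v w x :: "'b :: real_inner"
  assumes v: "norm v \<le> R" and w: "norm w \<le> R"
  shows "\<bar>loss v x - loss w x\<bar> \<le> 9 * R * norm (v - w)"
proof -
  define \<delta> where "\<delta> = norm (v - w)"
  have R: "0 \<le> R" and \<delta>: "0 \<le> \<delta>"
    using v norm_ge_zero order_trans unfolding \<delta>_def by blast+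
  show ?thesis
  proof (cases "norm x \<le> 2 * R")
    \<comment> \<open>All factors are at most 3R here, so the product rule for differences gives the
      constant 6R.\<close>
    case True
    have "\<bar>norm (x - v) - norm (x - w)\<bar> \<le> \<delta>" "\<bar>norm (x + v) - norm (x + w)\<bar> \<le> \<delta>"
      using norm_triangle_ineq3[of "x - v" "x - w"] norm_triangle_ineq3[of "x + v" "x + w"]
      by (simp_all add: \<delta>_def norm_minus_commute)
    moreover have "norm (x + v) \<le> 3 * R" "norm (x - w) \<le> 3 * R"
      using norm_triangle_ineq[of x v] norm_triangle_ineq4[of x w] True v w by linarith+
    ultimately have "\<bar>(norm (x - v) - norm (x - w)) * norm (x + v)\<bar> \<le> \<delta> * (3 * R)"
        "\<bar>norm (x - w) * (norm (x + v) - norm (x + w))\<bar> \<le> 3 * R * \<delta>"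
      using R by (auto simp: abs_mult intro!: mult_mono)
    moreover have "loss v x - loss w x =
        (norm (x - v) - norm (x - w)) * norm (x + v) + norm (x - w) * (norm (x + v) - norm (x + w))"
      by (simp add: loss_def algebra_simps)
    moreover have "0 \<le> R * \<delta>"
      using R \<delta> by simp
    ultimately show ?thesis
      unfolding \<delta>_def[symmetric] by (simp add: mult.commute)
  next
    case False
    define s where "s = (norm x)\<^sup>2"
    define a where "a = norm (x - v) * norm (x + v)"
    define b where "b = norm (x - w) * norm (x + w)"
    have s: "4 * R\<^sup>2 < s"
      using False R power_strict_mono[of "2 * R" "norm x" 2]
      by (simp add: s_def power_mult_distrib)
    then have s0: "0 < s"
      using zero_le_power2[of R] by linarith
    have v2: "(norm v)\<^sup>2 \<le> R\<^sup>2" and w2: "(norm w)\<^sup>2 \<le> R\<^sup>2"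
      using v w by (auto intro: power_mono)
    \<comment> \<open>Since ||v||^2 and ||w||^2 are at most R^2 < s/4, each product is at least
      3s/4.\<close>
    have sum_ge: "3 / 2 * s \<le> a + b"
      using abs_diff_le_norm_diff_mult_norm_add[of x v] abs_diff_le_norm_diff_mult_norm_add[of x w]
        v2 w2 s unfolding a_def b_def s_def by linarith
    have vw: "norm (v + w) \<le> 2 * R"
      using norm_triangle_ineq[of v w] v w by linarith
    have "(norm v)\<^sup>2 - (norm w)\<^sup>2 = (v - w) \<bullet> (v + w)"
      by (simp add: power2_norm_eq_inner inner_diff_left inner_add_right inner_commute[of w v])
    also have "\<bar>\<dots>\<bar> \<le> \<delta> * norm (v + w)"
      unfolding \<delta>_def by (rule Cauchy_Schwarz_ineq2)
    also have "\<dots> \<le> \<delta> * (2 * R)"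
      using vw \<delta> by (rule mult_left_mono)
    finally have 1: "\<bar>(norm v)\<^sup>2 - (norm w)\<^sup>2\<bar> \<le> \<delta> * (2 * R)" .
    have "\<bar>x \<bullet> (v - w)\<bar> * \<bar>x \<bullet> (v + w)\<bar> \<le> (norm x * \<delta>) * (norm x * (2 * R))"
      using Cauchy_Schwarz_ineq2[of x "v - w"] vw R \<delta>
      by (intro mult_mono order_trans[OF Cauchy_Schwarz_ineq2[of x "v + w"]] mult_left_mono)
        (auto simp: \<delta>_def)
    then have 2: "\<bar>(x \<bullet> (v - w)) * (x \<bullet> (v + w))\<bar> \<le> 2 * s * R * \<delta>"
      by (simp add: abs_mult s_def power2_eq_square mult_ac)
    have "(a - b) * (a + b) =
        (2 * s + (norm v)\<^sup>2 + (norm w)\<^sup>2) * ((norm v)\<^sup>2 - (norm w)\<^sup>2)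
          - 4 * ((x \<bullet> (v - w)) * (x \<bullet> (v + w)))"
    proof -
      have "(a - b) * (a + b) = a\<^sup>2 - b\<^sup>2"
        by (simp add: power2_eq_square algebra_simps)
      then show ?thesis
        unfolding a_def b_def power2_norm_diff_mult_norm_add s_def[symmetric]
        by (simp add: inner_diff_right inner_add_right power2_eq_square algebra_simps)
    qed
    also have "\<bar>\<dots>\<bar> \<le> \<bar>(2 * s + (norm v)\<^sup>2 + (norm w)\<^sup>2) * ((norm v)\<^sup>2 - (norm w)\<^sup>2)\<bar>
        + \<bar>4 * ((x \<bullet> (v - w)) * (x \<bullet> (v + w)))\<bar>"
      by (rule abs_triangle_ineq4)
    also have "\<dots> \<le> (5 / 2 * s) * (\<delta> * (2 * R)) + 8 * s * R * \<delta>"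
    proof (rule add_mono)
      have "\<bar>2 * s + (norm v)\<^sup>2 + (norm w)\<^sup>2\<bar> \<le> 5 / 2 * s"
        using v2 w2 s s0 zero_le_power2[of "norm v"] zero_le_power2[of "norm w"] by linarith
      then show "\<bar>(2 * s + (norm v)\<^sup>2 + (norm w)\<^sup>2) * ((norm v)\<^sup>2 - (norm w)\<^sup>2)\<bar>
          \<le> (5 / 2 * s) * (\<delta> * (2 * R))"
        unfolding abs_mult using 1 s0 by (intro mult_mono) auto
    qed (use 2 in linarith)
    \<comment> \<open>The two terms add up to 13 s R \<delta>; dividing by 3s/2 leaves 26/3, which
      is below 9.\<close>
    also have "\<dots> = (3 / 2 * s) * (26 / 3 * (R * \<delta>))"
      by simp
    finally have "\<bar>a - b\<bar> * \<bar>a + b\<bar> \<le> (3 / 2 * s) * (26 / 3 * (R * \<delta>))"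
      by (simp add: abs_mult)
    moreover have "\<bar>a - b\<bar> * (3 / 2 * s) \<le> \<bar>a - b\<bar> * \<bar>a + b\<bar>"
      by (intro mult_left_mono order_trans[OF sum_ge abs_ge_self]) simp
    ultimately have "(3 / 2 * s) * \<bar>a - b\<bar> \<le> (3 / 2 * s) * (26 / 3 * (R * \<delta>))"
      by (simp add: mult.commute)
    then have "\<bar>a - b\<bar> \<le> 26 / 3 * (R * \<delta>)"
      using s0 by (subst (asm) mult_le_cancel_left_pos) auto
    moreover have "0 \<le> R * \<delta>"
      using R \<delta> by simp
    ultimately show ?thesis
      by (simp add: loss_def a_def b_def \<delta>_def[symmetric] s_def[symmetric])
  qed
qed

section \<open>Population and sample objective\<close>

lemma objective_eq: "objective Q v = (\<integral>x. loss v x \<partial>Q)"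
  by (simp add: objective_def loss_def)

lemma sample_objective_eq: "sample_objective n x v = (\<Sum>i<n. loss v (x i)) / real n"
  by (simp add: sample_objective_def loss_def)

lemma sample_objective_0 [simp]: "sample_objective n x 0 = 0"
  by (simp add: sample_objective_def power2_eq_square)

text \<open>Integrates the pointwise bound. Stated for any Borel law, so that it serves both
  \<open>P\<close> and the empirical measures.\<close>

lemma objective_lipschitz:
  assumes "prob_space Q" and [measurable_cong]: "sets Q = sets borel"
    and v: "norm v \<le> R" and w: "norm w \<le> R"
  shows "\<bar>objective Q v - objective Q w\<bar> \<le> 9 * R * norm (v - w)"
proof -
  interpret prob_space Q by fact
  have int: "integrable Q (loss u)" for u
    by (rule integrable_const_bound[where B = "(norm u)\<^sup>2"]) (auto simp: abs_loss_le)
  have "objective Q v - objective Q w = (\<integral>x. loss v x - loss w x \<partial>Q)"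
    by (simp add: objective_eq int)
  also have "\<bar>\<dots>\<bar> \<le> (\<integral>x. \<bar>loss v x - loss w x\<bar> \<partial>Q)"
    by (rule integral_abs_bound)
  also have "\<dots> \<le> (\<integral>x. 9 * R * norm (v - w) \<partial>Q)"
    using loss_lipschitz[OF v w] by (intro integral_mono integrable_abs) (auto simp: int)
  finally show ?thesis
    by (simp add: prob_space)
qed

lemma continuous_on_objective:
  assumes "prob_space Q" "sets Q = sets borel" "bounded K"
  shows "continuous_on K (objective Q)"
proof -
  obtain R where R: "\<And>u. u \<in> K \<Longrightarrow> norm u \<le> R"
    using \<open>bounded K\<close> by (auto simp: bounded_iff)
  \<comment> \<open>If \<open>K\<close> is empty, \<open>R\<close> may be negative; the absolute
    value keeps the constant nonnegative.\<close>
  have "(\<bar>9 * R\<bar>)-lipschitz_on K (objective Q)"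
  proof (rule lipschitz_onI)
    fix u w assume "u \<in> K" "w \<in> K"
    then have "\<bar>objective Q u - objective Q w\<bar> \<le> 9 * R * norm (u - w)"
      by (intro objective_lipschitz assms R)
    also have "\<dots> \<le> \<bar>9 * R\<bar> * norm (u - w)"
      by (intro mult_right_mono) auto
    finally show "dist (objective Q u) (objective Q w) \<le> \<bar>9 * R\<bar> * dist u w"
      by (simp add: dist_norm)
  qed simp
  then show ?thesis
    by (rule lipschitz_on_continuous_on)
qed

section \<open>Empirical measures as averages over the sample\<close>

lemma sets_empirical [simp]: "sets (empirical n x) = sets borel"
  by (simp add: empirical_def)

lemma prob_space_empirical:
  assumes "1 \<le> n"
  shows "prob_space (empirical n x)"
  unfolding empirical_def using assms
  by (intro prob_space.prob_space_distr prob_space_uniform_count_measure)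
    (auto simp: measurable_def space_uniform_count_measure sets_uniform_count_measure
        lessThan_empty_iff)

lemma sample_objective_lipschitz:
  assumes "1 \<le> n" "norm v \<le> R" "norm w \<le> R"
  shows "\<bar>sample_objective n x v - sample_objective n x w\<bar> \<le> 9 * R * norm (v - w)"
  using objective_lipschitz[OF prob_space_empirical[OF assms(1)] sets_empirical assms(2,3)]
  by (simp add: objective_empirical)

lemma measure_empirical_eq_sum:
  fixes x :: "nat \<Rightarrow> 'b :: topological_space"
  assumes "A \<in> sets borel"
  shows "measure (empirical n x) A = (\<Sum>i<n. indicator A (x i)) / real n"
proof -
  have "(\<Sum>i<n. indicator A (x i)) = real (card {i \<in> {..<n}. x i \<in> A})"
    by (simp add: indicator_def sum.If_cases Int_def)
  then show ?thesis
    by (simp add: measure_empirical[OF assms])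
qed

section \<open>Growth of the sample objective away from the origin\<close>

text \<open>Sample points within radius r contribute at least ||u||^2 - 2 r^2 each, the others at
  least -||u||^2. Averaging with weights p and 1 - p, where p is the mass of the ball, gives the
  bound.\<close>

lemma sample_objective_ge:
  fixes u :: "real ^ 'p"
  assumes n: "1 \<le> n" and r: "0 \<le> r" "r \<le> norm u"
  shows "2 * ((norm u)\<^sup>2 - r\<^sup>2) * measure (empirical n x) (cball 0 r) - (norm u)\<^sup>2
           \<le> sample_objective n x u"
proof -
  have *: "2 * ((norm u)\<^sup>2 - r\<^sup>2) * indicator (cball 0 r) y - (norm u)\<^sup>2 \<le> loss u y" for y
  proof (cases "norm y \<le> r")
    case True
    then have "(norm y)\<^sup>2 \<le> r\<^sup>2"
      by (intro power_mono) auto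
    then show ?thesis
      using loss_ge[of u y] True by simp
  next
    case False
    then show ?thesis
      using abs_loss_le[of u y] by simp
  qed
  have "2 * ((norm u)\<^sup>2 - r\<^sup>2) * measure (empirical n x) (cball 0 r) - (norm u)\<^sup>2 =
      (\<Sum>i<n. 2 * ((norm u)\<^sup>2 - r\<^sup>2) * indicator (cball 0 r) (x i) - (norm u)\<^sup>2) / real n"
    using n by (simp add: measure_empirical_eq_sum sum_subtractf sum_distrib_left diff_divide_distrib)
  also have "\<dots> \<le> sample_objective n x u"
    unfolding sample_objective_eq by (intro divide_right_mono sum_mono *) simp
  finally show ?thesis .
qed

text \<open>Mass 3/4 turns the previous bound into ||u||^2 / 2 - 3 r^2 / 2, positive once ||u|| >
  2r.\<close>

lemma sample_objective_pos_far:
  fixes u :: "real ^ 'p"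
  assumes n: "1 \<le> n" and r: "0 \<le> r" "2 * r < norm u"
    and p: "3 / 4 \<le> measure (empirical n x) (cball 0 r)"
  shows "0 < sample_objective n x u"
proof -
  have sq: "4 * r\<^sup>2 < (norm u)\<^sup>2"
    using r power_strict_mono[of "2 * r" "norm u" 2] by (simp add: power_mult_distrib)
  then have "r\<^sup>2 \<le> (norm u)\<^sup>2"
    using zero_le_power2[of r] by linarith
  then have "2 * ((norm u)\<^sup>2 - r\<^sup>2) * (3 / 4)
      \<le> 2 * ((norm u)\<^sup>2 - r\<^sup>2) * measure (empirical n x) (cball 0 r)"
    by (intro mult_left_mono[OF p]) simp
  moreover have "2 * ((norm u)\<^sup>2 - r\<^sup>2) * measure (empirical n x) (cball 0 r) - (norm u)\<^sup>2
      \<le> sample_objective n x u"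
    using r by (intro sample_objective_ge n) auto
  ultimately show ?thesis
    using sq zero_le_power2[of r] by argo
qed

section \<open>The search radius\<close>

text \<open>The limits of the cdf make the set of candidates nonempty (q < 1) and bounded below (0 <
  q); right continuity then passes the inequality to the infimum.\<close>

lemma (in real_distribution) quantile_attained:
  assumes q: "0 < q" "q < 1"
  shows "q \<le> measure M {..quantile q M}"
proof -
  define S where "S = {t. q \<le> cdf M t}"
  have "eventually (\<lambda>t. q < cdf M t) at_top"
    using order_tendstoD(1)[OF cdf_lim_at_top_prob q(2)] .
  then obtain t where "q < cdf M t"
    by (auto simp: eventually_at_top_linorder)
  then have ne: "S \<noteq> {}"
    by (auto simp: S_def intro: less_imp_le)
  have "eventually (\<lambda>t. cdf M t < q) at_bot"
    using order_tendstoD(2)[OF cdf_lim_at_bot q(1)] .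
  then obtain t0 where t0: "cdf M t0 < q"
    by (auto simp: eventually_at_bot_linorder)
  have bdd: "bdd_below S"
  proof
    fix s assume "s \<in> S"
    then show "t0 \<le> s"
      using cdf_nondecreasing[of s t0] t0 by (fastforce simp: S_def)
  qed
  have "eventually (\<lambda>t. q \<le> cdf M t) (at_right (Inf S))"
  proof (rule eventually_at_right_less[THEN eventually_mono])
    fix t assume "Inf S < t"
    then obtain s where "s \<in> S" "s < t"
      using cInf_less_iff[OF ne bdd] by blast
    then show "q \<le> cdf M t"
      using cdf_nondecreasing[of s t] by (auto simp: S_def)
  qed
  then have "q \<le> cdf M (Inf S)"
    using cdf_is_right_cont[of "Inf S"] unfolding continuous_within
    by (intro tendsto_lowerbound[where F = "at_right (Inf S)"]) auto
  then show ?thesis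
    by (simp add: S_def quantile_def cdf_def)
qed

lemma measure_empirical_norm:
  "measure (empirical n (\<lambda>i. norm (x i))) {..t} = measure (empirical n x) (cball 0 t)"
  by (simp add: measure_empirical)

lemma radius_quantile_attained:
  assumes "1 \<le> n"
  shows "3 / 4 \<le> measure (empirical n x) (cball 0 (radius_quantile n x))"
proof -
  interpret prob_space "empirical n (\<lambda>i. norm (x i))"
    by (rule prob_space_empirical) fact
  interpret real_distribution "empirical n (\<lambda>i. norm (x i))"
    by unfold_locales (simp_all add: empirical_def)
  show ?thesis
    using quantile_attained[of "3 / 4"]
    by (simp add: radius_quantile_def measure_empirical_norm)
qed

lemma radius_quantile_nonneg:
  assumes "1 \<le> n"
  shows "0 \<le> radius_quantile n x"
proof (rule ccontr)
  assume "\<not> 0 \<le> radius_quantile n x"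
  then have "cball 0 (radius_quantile n x) = ({} :: (real ^ 'a) set)"
    by simp
  then show False
    using radius_quantile_attained[OF assms, of x] by simp
qed

text \<open>
  The largest root of the radius polynomial is at least the explicit root
  \<open>a = r (1 + \<surd>(2 p)) / (2 p - 1)\<close>, beyond which the polynomial is positive.
\<close>

lemma sample_objective_pos_outside:
  fixes u :: "real ^ 'p"
  assumes n: "1 \<le> n" and u: "search_radius n x - 1 < norm u"
  shows "0 < sample_objective n x u"
proof -
  define r where "r = radius_quantile n x"
  define p where "p = measure (empirical n x) (cball 0 r)"
  define h where "h = norm u"
  define a where "a = r * (1 + sqrt (2 * p)) / (2 * p - 1)"
  interpret prob_space "empirical n x"
    by (rule prob_space_empirical) fact
  have r: "0 \<le> r"
    unfolding r_def by (rule radius_quantile_nonneg) fact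
  have p: "3 / 4 \<le> p" "p \<le> 1"
    using radius_quantile_attained[OF n, of x] by (auto simp: p_def r_def)
  have poly: "poly (radius_poly n x) t = (2 * p - 1) * t\<^sup>2 - 2 * r * t - r\<^sup>2" for t
    by (simp add: radius_poly_def Let_def p_def r_def power2_eq_square algebra_simps)
  have sq: "1 \<le> sqrt (2 * p)"
    using p by simp
  have a_eq: "(2 * p - 1) * a = r * (1 + sqrt (2 * p))"
    using p by (simp add: a_def)
  \<comment> \<open>Completing the square: (2p - 1) a - r = r sqrt(2p) by the choice of a.\<close>
  have "(2 * p - 1) * ((2 * p - 1) * a\<^sup>2 - 2 * r * a - r\<^sup>2) =
      ((2 * p - 1) * a - r)\<^sup>2 - 2 * p * r\<^sup>2"
    by (simp add: power2_eq_square algebra_simps)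
  also have "\<dots> = 0"
    unfolding a_eq using p by (simp add: algebra_simps power_mult_distrib)
  finally have root: "(2 * p - 1) * a\<^sup>2 - 2 * r * a - r\<^sup>2 = 0"
    using p by simp
  \<comment> \<open>The leading coefficient 2p - 1 is at least 1/2, so the set of roots is finite
    and \<open>Max\<close> is meaningful.\<close>
  have "radius_poly n x \<noteq> 0"
    using p by (simp add: radius_poly_def Let_def p_def r_def)
  then have "a \<le> Max {h. poly (radius_poly n x) h = 0}"
    using root by (intro Max_ge poly_roots_finite) (simp_all add: poly)
  then have "a \<le> search_radius n x - 1"
    by (simp add: search_radius_def)
  with u have ha: "a < h"
    by (simp add: h_def)
  \<comment> \<open>This gives r \<le> h via 2r \<le> (2p - 1) a \<le> a < h, and makes the second
    factor of the difference of the polynomial values at h and a positive.\<close>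
  have "2 * r \<le> (2 * p - 1) * a"
    unfolding a_eq using mult_left_mono[OF sq r] by (simp add: algebra_simps)
  moreover have a0: "0 \<le> a"
    unfolding a_def using p r by simp
  moreover have "(2 * p - 1) * a \<le> a"
    using mult_right_mono[of "2 * p - 1" 1 a] a0 p by simp
  ultimately have "r \<le> h" "0 < (h - a) * ((2 * p - 1) * (h + a) - 2 * r)"
    using ha r p
    by (auto intro!: mult_pos_pos add_strict_increasing simp: distrib_left)
  moreover have "(h - a) * ((2 * p - 1) * (h + a) - 2 * r) =
      (2 * p - 1) * h\<^sup>2 - 2 * r * h - r\<^sup>2 - ((2 * p - 1) * a\<^sup>2 - 2 * r * a - r\<^sup>2)"
    by (simp add: power2_eq_square algebra_simps)
  ultimately have pos: "0 < (2 * p - 1) * h\<^sup>2 - 2 * r * h - r\<^sup>2" and rh: "r \<le> h"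
    using root by simp_all
  \<comment> \<open>The lower bound from \<open>sample_objective_ge\<close> exceeds the polynomial
    at h by 2rh - 2pr^2 + r^2, which is nonnegative.\<close>
  have "p * r\<^sup>2 \<le> r * h"
    using mult_mono[OF p(2) mult_left_mono[OF rh r]] p r by (simp add: power2_eq_square)
  moreover have "2 * (h\<^sup>2 - r\<^sup>2) * p - h\<^sup>2 =
      (2 * p - 1) * h\<^sup>2 - 2 * r * h - r\<^sup>2 + (2 * (r * h) - 2 * (p * r\<^sup>2) + r\<^sup>2)"
    by (simp add: algebra_simps)
  ultimately have "(2 * p - 1) * h\<^sup>2 - 2 * r * h - r\<^sup>2 \<le> 2 * (h\<^sup>2 - r\<^sup>2) * p - h\<^sup>2"
    using zero_le_power2[of r] by linarith
  also have "\<dots> \<le> sample_objective n x u"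
    using sample_objective_ge[OF n r, of u x] rh by (simp add: h_def p_def)
  finally show ?thesis
    using pos by linarith
qed

text \<open>The objective vanishes at 0 and is positive outside the search ball, so a minimizer over
  this random ball is a global one.\<close>

lemma minimizer_le:
  assumes n: "1 \<le> n"
    and v: "is_arg_min (sample_objective n x) (\<lambda>u. u \<in> cball 0 (search_radius n x + 1 / 2)) v"
  shows "sample_objective n x v \<le> sample_objective n x u"
proof (cases "norm u \<le> search_radius n x + 1 / 2")
  case True
  then show ?thesis
    using v by (auto simp: is_arg_min_linorder)
next
  case False
  \<comment> \<open>The ball contains v, so its radius is nonnegative and it contains 0.\<close>
  have "norm v \<le> search_radius n x + 1 / 2"
    using v by (simp add: is_arg_min_def)
  then have "0 \<le> search_radius n x + 1 / 2"
    using norm_ge_zero order_trans by blast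
  then have "sample_objective n x v \<le> 0"
    using v by (simp add: is_arg_min_linorder) (metis norm_zero sample_objective_0)
  also have "\<dots> < sample_objective n x u"
    using False by (intro sample_objective_pos_outside n) simp
  finally show ?thesis
    by simp
qed

section \<open>Consistency\<close>

lemma (in prob_space) weak_law_bounded:
  fixes X :: "nat \<Rightarrow> 'a \<Rightarrow> 'b :: topological_space" and g :: "'b \<Rightarrow> real"
  assumes indep: "indep_vars (\<lambda>_. borel) X UNIV"
    and distr: "\<And>i. distr M borel (X i) = P"
    and g [measurable]: "g \<in> borel_measurable borel"
    and bound: "\<And>x. \<bar>g x\<bar> \<le> b"
    and \<epsilon>: "0 < \<epsilon>"
  shows "(\<lambda>n. prob {\<omega> \<in> space M. \<epsilon> \<le> \<bar>(\<Sum>i<n. g (X i \<omega>)) / real n - (\<integral>x. g x \<partial>P)\<bar>}) \<longlonglongrightarrow> 0"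
proof (rule tendsto_sandwich[OF _ _ tendsto_const])
  have X [measurable]: "random_variable borel (X i)" for i
    using indep by (auto simp: indep_vars_def)
  \<comment> \<open>Adding 1 gives the interval [-c, c] in Hoeffding's inequality positive
    length.\<close>
  define c where "c = \<bar>b\<bar> + 1"
  have c: "\<bar>g x\<bar> \<le> c" "0 < c" for x
    using bound[of x] by (auto simp: c_def)
  have mean: "expectation (\<lambda>\<omega>. g (X 0 \<omega>)) = (\<integral>x. g x \<partial>P)"
    by (subst distr[of 0, symmetric], subst integral_distr) auto
  show "eventually (\<lambda>n. prob {\<omega> \<in> space M.
      \<epsilon> \<le> \<bar>(\<Sum>i<n. g (X i \<omega>)) / real n - (\<integral>x. g x \<partial>P)\<bar>}
      \<le> 2 * exp (- 2 * real n * \<epsilon>\<^sup>2 / (c - (- c))\<^sup>2)) sequentially"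
    using eventually_gt_at_top[of 0]
  proof eventually_elim
    fix n :: nat assume n: "0 < n"
    interpret Hoeffding_ineq_iid M "{..<n}" "\<lambda>i \<omega>. g (X i \<omega>)" "\<lambda>\<omega>. g (X 0 \<omega>)" "- c" c
        "expectation (\<lambda>\<omega>. g (X 0 \<omega>))"
    proof unfold_locales
      show "indep_vars (\<lambda>_. borel) (\<lambda>i \<omega>. g (X i \<omega>)) {..<n}"
        by (rule indep_vars_compose2[OF indep_vars_subset[OF indep]]) auto
      have "distr M borel (\<lambda>\<omega>. g (X i \<omega>)) = distr P borel g" for i
        by (subst distr[of i, symmetric], subst distr_distr) (auto simp: comp_def)
      then show "distr M borel (\<lambda>\<omega>. g (X i \<omega>)) = distr M borel (\<lambda>\<omega>. g (X 0 \<omega>))" for i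
        by simp
      show "AE \<omega> in M. g (X 0 \<omega>) \<in> {- c..c}"
        using c(1) by (auto simp: abs_le_iff minus_le_iff)
    qed auto
    show "prob {\<omega> \<in> space M. \<epsilon> \<le> \<bar>(\<Sum>i<n. g (X i \<omega>)) / real n - (\<integral>x. g x \<partial>P)\<bar>}
        \<le> 2 * exp (- 2 * real n * \<epsilon>\<^sup>2 / (c - (- c))\<^sup>2)"
      using Hoeffding_ineq_abs_ge'[of \<epsilon>] \<epsilon> c(2) n by (simp add: mean lessThan_empty_iff)
  qed
  have "filterlim (\<lambda>n. real n * (2 * \<epsilon>\<^sup>2 / (2 * c)\<^sup>2)) at_top sequentially"
    using c(2) \<epsilon>
    by (intro filterlim_at_top_mult_tendsto_pos[OF tendsto_const _ filterlim_real_sequentially]) auto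
  then have "(\<lambda>n. exp (- (real n * (2 * \<epsilon>\<^sup>2 / (2 * c)\<^sup>2)))) \<longlonglongrightarrow> 0"
    by (intro filterlim_compose[OF exp_at_bot] filterlim_compose[OF filterlim_uminus_at_bot_at_top])
  from tendsto_mult_left[OF this, of 2]
  show "(\<lambda>n. 2 * exp (- 2 * real n * \<epsilon>\<^sup>2 / (c - (- c))\<^sup>2)) \<longlonglongrightarrow> 0"
    by (simp add: mult_ac)
qed simp

text \<open>A fixed ball of mass above 7/8 has sample mass at least 3/4 unless the weak law errs by
  1/8. The exceptional events are measurable and do not depend on u, so arbitrary minimizers may be
  inserted later.\<close>

lemma (in prob_space) sample_objective_pos_far_in_prob:
  fixes X :: "nat \<Rightarrow> 'a \<Rightarrow> real ^ 'p"
  assumes indep: "indep_vars (\<lambda>_. borel) X UNIV"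
    and distr: "\<And>i. distr M borel (X i) = P"
  obtains R B where "\<And>n. B n \<in> events" "(\<lambda>n. prob (B n)) \<longlonglongrightarrow> 0"
    "\<And>n \<omega> u. 1 \<le> n \<Longrightarrow> \<omega> \<in> space M - B n \<Longrightarrow> R < norm u \<Longrightarrow>
       0 < sample_objective n (\<lambda>i. X i \<omega>) u"
proof -
  have X [measurable]: "random_variable borel (X i)" for i
    using indep by (auto simp: indep_vars_def)
  interpret P: prob_space P
    using prob_space_distr[OF X[of 0]] by (simp add: distr)
  have [measurable_cong, simp]: "sets P = sets borel"
    by (simp flip: distr[of 0])
  have "(\<lambda>m. measure P (cball 0 (real m))) \<longlonglongrightarrow> measure P (\<Union>m. cball 0 (real m))"
    by (rule P.finite_Lim_measure_incseq) (auto simp: incseq_def)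
  also have "(\<Union>m. cball 0 (real m)) = space P"
    using sets_eq_imp_space_eq[of P borel] real_arch_simple by auto
  finally have "eventually (\<lambda>m. 7 / 8 < measure P (cball 0 (real m))) sequentially"
    by (rule order_tendstoD) (simp add: P.prob_space)
  then obtain m where m: "7 / 8 < measure P (cball 0 (real m))"
    by (auto simp: eventually_sequentially)
  define g :: "real ^ 'p \<Rightarrow> real" where "g = indicator (cball 0 (real m))"
  have g [measurable]: "g \<in> borel_measurable borel"
    unfolding g_def by (intro borel_measurable_indicator borel_closed closed_cball)
  define B where
    "B n = {\<omega> \<in> space M. 1 / 8 \<le> \<bar>(\<Sum>i<n. g (X i \<omega>)) / real n - (\<integral>x. g x \<partial>P)\<bar>}" for n
  have int_g: "(\<integral>x. g x \<partial>P) = measure P (cball 0 (real m))"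
    using sets_eq_imp_space_eq[of P borel] by (simp add: g_def)
  show ?thesis
  proof (rule that[of B "2 * real m"])
    show "B n \<in> events" for n
      unfolding B_def by measurable
    show "(\<lambda>n. prob (B n)) \<longlonglongrightarrow> 0"
      unfolding B_def
      by (rule weak_law_bounded[OF indep distr g, where b = 1]) (auto simp: g_def indicator_def)
    fix n :: nat and \<omega> and u :: "real ^ 'p"
    assume n: "1 \<le> n" and \<omega>: "\<omega> \<in> space M - B n" and u: "2 * real m < norm u"
    have "\<bar>(\<Sum>i<n. g (X i \<omega>)) / real n - measure P (cball 0 (real m))\<bar> < 1 / 8"
      using \<omega> by (simp add: B_def int_g not_le)
    then have "3 / 4 \<le> (\<Sum>i<n. g (X i \<omega>)) / real n"
      using m by linarith
    then have "3 / 4 \<le> measure (empirical n (\<lambda>i. X i \<omega>)) (cball 0 (real m))"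
      by (simp add: measure_empirical_eq_sum g_def)
    then show "0 < sample_objective n (\<lambda>i. X i \<omega>) u"
      using n u by (intro sample_objective_pos_far) auto
  qed
qed

text \<open>By compactness the population gap over \<open>K\<close> is at least some 3 \<eta> > 0.
  One \<eta> pays for the sampling error at c, one for that at a net point, one for the move from
  the net point to u.\<close>

lemma (in prob_space) sample_objective_separation_in_prob:
  fixes X :: "nat \<Rightarrow> 'a \<Rightarrow> real ^ 'p"
  assumes indep: "indep_vars (\<lambda>_. borel) X UNIV"
    and distr: "\<And>i. distr M borel (X i) = P"
    and K: "compact K" and c: "\<And>u. u \<in> K \<Longrightarrow> objective P c < objective P u"
  obtains B where "\<And>n. B n \<in> events" "(\<lambda>n. prob (B n)) \<longlonglongrightarrow> 0"
    "\<And>n \<omega> u. 1 \<le> n \<Longrightarrow> \<omega> \<in> space M - B n \<Longrightarrow> u \<in> K \<Longrightarrow>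
       sample_objective n (\<lambda>i. X i \<omega>) c < sample_objective n (\<lambda>i. X i \<omega>) u"
proof (cases "K = {}")
  case True
  then show ?thesis
    using that[of "\<lambda>_. {}"] by simp
next
  case False
  have X [measurable]: "random_variable borel (X i)" for i
    using indep by (auto simp: indep_vars_def)
  interpret P: prob_space P
    using prob_space_distr[OF X[of 0]] by (simp add: distr)
  have "sets P = sets borel"
    by (simp flip: distr[of 0])
  then have "continuous_on K (objective P)"
    by (intro continuous_on_objective P.prob_space_axioms compact_imp_bounded K)
  then obtain u0 where u0: "u0 \<in> K" "\<And>u. u \<in> K \<Longrightarrow> objective P u0 \<le> objective P u"
    using continuous_attains_inf[OF K False] by metis
  define \<eta> where "\<eta> = (objective P u0 - objective P c) / 3"
  have \<eta>: "0 < \<eta>"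
    using c[OF u0(1)] by (simp add: \<eta>_def)
  obtain R where R: "0 < R" "\<And>u. u \<in> K \<Longrightarrow> norm u \<le> R"
    using compact_imp_bounded[OF K] by (auto simp: bounded_pos)
  \<comment> \<open>With the Lipschitz constant 9R on \<open>K\<close>, a move by less than \<delta>
    changes the sample objective by less than \<eta>.\<close>
  define \<delta> where "\<delta> = \<eta> / (9 * R)"
  have \<delta>: "0 < \<delta>"
    using \<eta> R by (simp add: \<delta>_def)
  obtain T where T: "finite T" "T \<subseteq> K" "K \<subseteq> (\<Union>t\<in>T. ball t \<delta>)"
    using compactE_image[OF K, of K "\<lambda>t. ball t \<delta>"] \<delta>
    by (metis UN_I centre_in_ball open_ball subsetI)
  define B where "B n t =
    {\<omega> \<in> space M. \<eta> \<le> \<bar>(\<Sum>i<n. loss t (X i \<omega>)) / real n - objective P t\<bar>}" for n t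
  have B [measurable]: "B n t \<in> events" for n t
    unfolding B_def by measurable
  have B0: "(\<lambda>n. prob (B n t)) \<longlonglongrightarrow> 0" for t
    unfolding B_def objective_eq
    by (rule weak_law_bounded[OF indep distr borel_measurable_loss abs_loss_le \<eta>])
  have close: "\<bar>sample_objective n (\<lambda>i. X i \<omega>) t - objective P t\<bar> < \<eta>"
    if "\<omega> \<in> space M - B n t" for n \<omega> t
    using that by (auto simp: B_def sample_objective_eq)
  show ?thesis
  \<comment> \<open>The net is finite and independent of n and the sample, so a union bound
    suffices.\<close>
  proof (rule that[of "\<lambda>n. \<Union>t\<in>insert c T. B n t"])
    show "(\<Union>t\<in>insert c T. B n t) \<in> events" for n
      using T(1) by (intro sets.finite_UN) auto
    show "(\<lambda>n. prob (\<Union>t\<in>insert c T. B n t)) \<longlonglongrightarrow> 0"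
    proof (rule tendsto_sandwich[OF _ _ tendsto_const])
      show "(\<lambda>n. \<Sum>t\<in>insert c T. prob (B n t)) \<longlonglongrightarrow> 0"
        by (rule tendsto_null_sum) (rule B0)
      show "eventually (\<lambda>n. prob (\<Union>t\<in>insert c T. B n t) \<le> (\<Sum>t\<in>insert c T. prob (B n t))) sequentially"
        using T(1) by (intro always_eventually allI finite_measure_subadditive_finite) auto
    qed simp
    fix n :: nat and \<omega> u
    assume n: "1 \<le> n" and \<omega>: "\<omega> \<in> space M - (\<Union>t\<in>insert c T. B n t)" and u: "u \<in> K"
    let ?f = "sample_objective n (\<lambda>i. X i \<omega>)"
    obtain t where t: "t \<in> T" "norm (t - u) < \<delta>"
      using T(3) u by (auto simp: dist_norm)
    have "\<bar>?f t - ?f u\<bar> \<le> 9 * R * norm (t - u)"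
      using t u T(2) R(2) by (intro sample_objective_lipschitz n) auto
    also have "\<dots> < 9 * R * \<delta>"
      using t R(1) by (intro mult_strict_left_mono) auto
    also have "\<dots> = \<eta>"
      using R(1) by (simp add: \<delta>_def)
    finally have "\<bar>?f t - ?f u\<bar> < \<eta>" .
    moreover have "\<bar>?f t - objective P t\<bar> < \<eta>" "\<bar>?f c - objective P c\<bar> < \<eta>"
      using \<omega> t by (auto intro!: close)
    moreover have "objective P u0 \<le> objective P t" "objective P u0 = objective P c + 3 * \<eta>"
      using u0(2) t(1) T(2) by (auto simp: \<eta>_def field_simps)
    ultimately show "?f c < ?f u"
      by linarith
  qed
qed

section \<open>Outer probability and the choice of signs\<close>

lemma (in prob_space) outer_measure_of_tendsto_0:
  assumes B: "\<And>n. B n \<in> events" "(\<lambda>n. prob (B n)) \<longlonglongrightarrow> 0"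
    and A: "eventually (\<lambda>n. A n \<subseteq> B n) sequentially"
  shows "(\<lambda>n. outer_measure_of M (A n)) \<longlonglongrightarrow> 0"
proof (rule tendsto_sandwich[OF _ _ tendsto_const])
  show "(\<lambda>n. ennreal (prob (B n))) \<longlonglongrightarrow> 0"
    using tendsto_ennrealI[OF B(2)] by simp
  show "eventually (\<lambda>n. outer_measure_of M (A n) \<le> ennreal (prob (B n))) sequentially"
    using A
  proof eventually_elim
    fix n assume "A n \<subseteq> B n"
    from outer_measure_of_mono[OF this, of M] B(1)[of n]
    show "outer_measure_of M (A n) \<le> ennreal (prob (B n))"
      by (simp add: emeasure_eq_measure)
  qed
qed simp

text \<open>The squared norms differ by 4 u.c, so the sign of u.c tells which of c and -c is nearer
  to u.\<close>

lemma norm_add_ge_norm_diff: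
  fixes u c :: "'b :: real_inner"
  assumes "0 \<le> u \<bullet> c"
  shows "norm (u - c) \<le> norm (u + c)"
  using assms by (simp add: norm_le inner_diff_left inner_diff_right inner_add_left
      inner_add_right inner_commute)

theorem theorem7:
  fixes M :: "'a measure"
    and X :: "nat \<Rightarrow> 'a \<Rightarrow> real ^ 'p"
    and P :: "(real ^ 'p) measure"
    and O\<^sub>P \<Lambda> :: "real ^ 'p ^ 'p"
    and k :: 'p
    and v :: "nat \<Rightarrow> 'a \<Rightarrow> real ^ 'p"
    and \<psi> :: real
  assumes "CARD('p) \<ge> 2"
    and "orthogonal_matrix O\<^sub>P"
    and "\<Lambda> \<in> spiked_scales k"
    and "P \<in> elliptical_class O\<^sub>P \<Lambda>"
    and "largest_eigenvalue (sign_covariance P) > 1 / 2"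
    and "prob_space M"
    and "prob_space.indep_vars M (\<lambda>_. borel) X UNIV"
    and "\<And>i. distr M borel (X i) = P"
    and "\<And>n \<omega>. n \<ge> 1 \<Longrightarrow> \<omega> \<in> space M \<Longrightarrow>
           is_arg_min (sample_objective n (\<lambda>i. X i \<omega>))
             (\<lambda>u. u \<in> cball 0 (search_radius n (\<lambda>i. X i \<omega>) + 1 / 2)) (v n \<omega>)"
    and "\<psi> > 0"
    and "{u. is_arg_min (objective P) (\<lambda>_. True) u} =
           {\<psi> *\<^sub>R column k O\<^sub>P, - (\<psi> *\<^sub>R column k O\<^sub>P)}"
  shows "\<exists>s :: nat \<Rightarrow> 'a \<Rightarrow> real.
           (\<forall>n. \<forall>\<omega>\<in>space M. s n \<omega> \<in> {-1, 1}) \<and>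
           (\<forall>n. v n \<in> borel_measurable M \<longrightarrow> s n \<in> borel_measurable M) \<and>
           tendsto_in_prob M (\<lambda>n \<omega>. s n \<omega> *\<^sub>R v n \<omega>) (\<psi> *\<^sub>R column k O\<^sub>P)"
proof -
  interpret prob_space M by fact
  define c where "c = \<psi> *\<^sub>R column k O\<^sub>P"
  \<comment> \<open>This sign moves \<open>v n \<omega>\<close> to the side of c. If the signed
    vector is still farther than \<epsilon> from c, then \<open>v n \<omega>\<close> is that far
    from both c and -c.\<close>
  define s where "s n \<omega> = (if 0 \<le> v n \<omega> \<bullet> c then 1 else - 1 :: real)" for n \<omega>
  have dist_s: "dist (s n \<omega> *\<^sub>R v n \<omega>) c \<le> norm (v n \<omega> - c)"
      "dist (s n \<omega> *\<^sub>R v n \<omega>) c \<le> norm (v n \<omega> + c)" for n \<omega>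
    using norm_add_ge_norm_diff[of "v n \<omega>" c] norm_add_ge_norm_diff[of "- v n \<omega>" c]
      norm_minus_commute[of "- v n \<omega>" c] norm_minus_commute[of "v n \<omega>" c]
    by (auto simp: s_def dist_norm add.commute)
  have min: "is_arg_min (objective P) (\<lambda>_. True) u \<longleftrightarrow> u = c \<or> u = - c" for u
    using assms(11) by (auto simp: c_def set_eq_iff)
  have lim: "(\<lambda>n. outer_measure_of M {\<omega> \<in> space M. \<epsilon> < dist (s n \<omega> *\<^sub>R v n \<omega>) c}) \<longlonglongrightarrow> 0"
    if \<epsilon>: "0 < \<epsilon>" for \<epsilon>
  proof -
    obtain R B where B: "\<And>n. B n \<in> events" "(\<lambda>n. prob (B n)) \<longlonglongrightarrow> 0"
      "\<And>n \<omega> u. 1 \<le> n \<Longrightarrow> \<omega> \<in> space M - B n \<Longrightarrow> R < norm u \<Longrightarrow>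
         0 < sample_objective n (\<lambda>i. X i \<omega>) u"
      using sample_objective_pos_far_in_prob[OF assms(7,8)] by metis
    \<comment> \<open>Removing open balls keeps \<open>K\<close> compact and excludes both
      population minimizers.\<close>
    define K where "K = cball 0 R - ball c \<epsilon> - ball (- c) \<epsilon>"
    have "compact K"
      unfolding K_def by (intro compact_diff compact_cball open_ball)
    moreover have "objective P c < objective P u" if "u \<in> K" for u
    proof -
      have "\<not> is_arg_min (objective P) (\<lambda>_. True) u"
        using that \<epsilon> by (auto simp: min K_def)
      then obtain y where "objective P y < objective P u"
        by (auto simp: is_arg_min_def)
      moreover have "objective P c \<le> objective P y"
        using min[of c] by (simp add: is_arg_min_linorder)
      ultimately show ?thesis
        by simp
    qed
    ultimately obtain C where C: "\<And>n. C n \<in> events" "(\<lambda>n. prob (C n)) \<longlonglongrightarrow> 0"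
      "\<And>n \<omega> u. 1 \<le> n \<Longrightarrow> \<omega> \<in> space M - C n \<Longrightarrow> u \<in> K \<Longrightarrow>
         sample_objective n (\<lambda>i. X i \<omega>) c < sample_objective n (\<lambda>i. X i \<omega>) u"
      using sample_objective_separation_in_prob[OF assms(7,8)] by metis
    show ?thesis
    proof (rule outer_measure_of_tendsto_0[where B = "\<lambda>n. B n \<union> C n"])
      show "B n \<union> C n \<in> events" for n
        using B(1) C(1) by auto
      show "(\<lambda>n. prob (B n \<union> C n)) \<longlonglongrightarrow> 0"
        by (rule tendsto_sandwich[OF _ _ tendsto_const tendsto_add_zero[OF B(2) C(2)]])
          (auto intro!: always_eventually measure_Un_le B(1) C(1))
      show "eventually (\<lambda>n. {\<omega> \<in> space M. \<epsilon> < dist (s n \<omega> *\<^sub>R v n \<omega>) c} \<subseteq> B n \<union> C n) sequentially"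
        using eventually_ge_at_top[of 1]
      proof eventually_elim
        fix n :: nat assume n: "1 \<le> n"
        show "{\<omega> \<in> space M. \<epsilon> < dist (s n \<omega> *\<^sub>R v n \<omega>) c} \<subseteq> B n \<union> C n"
        proof (rule subsetI, rule ccontr)
          fix \<omega> assume \<omega>: "\<omega> \<in> {\<omega> \<in> space M. \<epsilon> < dist (s n \<omega> *\<^sub>R v n \<omega>) c}"
            and "\<omega> \<notin> B n \<union> C n"
          then have good: "\<omega> \<in> space M - B n" "\<omega> \<in> space M - C n"
            by auto
          let ?f = "sample_objective n (\<lambda>i. X i \<omega>)"
          \<comment> \<open>Globality matters: c may lie outside the search ball. Below, u = 0
            confines \<open>v n \<omega>\<close> to the ball of radius \<open>R\<close>, and u = c
            contradicts the separation on \<open>K\<close>.\<close>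
          have le: "?f (v n \<omega>) \<le> ?f u" for u
            using good by (intro minimizer_le assms(9) n) auto
          have "norm (v n \<omega>) \<le> R"
            using B(3)[OF n good(1), of "v n \<omega>"] le[of 0] by fastforce
          moreover have "\<epsilon> < dist (v n \<omega>) c" "\<epsilon> < dist (v n \<omega>) (- c)"
            using \<omega> dist_s[of n \<omega>] by (simp_all add: dist_norm)
          ultimately have "v n \<omega> \<in> K"
            by (simp add: K_def dist_commute)
          then show False
            using C(3)[OF n good(2)] le[of c] by fastforce
        qed
      qed
    qed
  qed
  show ?thesis
  proof (intro exI[of _ s] conjI allI ballI impI)
    show "s n \<omega> \<in> {- 1, 1}" for n \<omega>
      by (simp add: s_def)
    show "s n \<in> borel_measurable M" if [measurable]: "v n \<in> borel_measurable M" for n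
      unfolding s_def by measurable
    show "tendsto_in_prob M (\<lambda>n \<omega>. s n \<omega> *\<^sub>R v n \<omega>) (\<psi> *\<^sub>R column k O\<^sub>P)"
      using lim by (simp add: tendsto_in_prob_def c_def)
  qed
qed

end
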